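(* Let $c\geq 2$ be an integer such that $c+1$ is a prime power. Then $R_{c,c+2}=\frac{c+2}{c}$, i.e., $\lim_{q\to\infty} M_{c,c+2}(q)/q^{2}=\frac{c+2}{c}$.
   Context: For $P\subseteq F^l$ over a finite alphabet $F$, $desc(P)=\{x\in F^l: \text{for every } i\in\{1,\ldots,l\} \text{ there is } y\in P \text{ with } x_i=y_i\}$. For an integer $c\geq 2$, a $c$-frameproof code of length $l$ is a subset $C\subseteq F^l$ with $desc(P)\cap C=P$ for every $P\subseteq C$ with $|P|\leq c$; it is $q$-ary if $|F|=q$. $M_{c,l}(q)$ denotes the largest cardinality of a $q$-ary $c$-frameproof code of length $l$, and $R_{c,l}=\lim_{q\to\infty} M_{c,l}(q)/q^{\lceil l/c\rceil}$ (note $\lceil (c+2)/c\rceil=2$ for $c\geq 2$). *)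

theory Defs
  imports Complex_Main "HOL-Computational_Algebra.Primes"
begin

definition words :: "'a set \<Rightarrow> nat \<Rightarrow> 'a list set" where
  "words F l = {x. length x = l \<and> set x \<subseteq> F}"

definition desc :: "'a set \<Rightarrow> nat \<Rightarrow> 'a list set \<Rightarrow> 'a list set" where
  "desc F l P = {x \<in> words F l. \<forall>i<l. \<exists>y\<in>P. x ! i = y ! i}"

definition frameproof :: "nat \<Rightarrow> 'a set \<Rightarrow> nat \<Rightarrow> 'a list set \<Rightarrow> bool" where
  "frameproof c F l C \<longleftrightarrow> C \<subseteq> words F l \<and>
     (\<forall>P. P \<subseteq> C \<and> card P \<le> c \<longrightarrow> desc F l P \<inter> C = P)"

definition M :: "nat \<Rightarrow> nat \<Rightarrow> nat \<Rightarrow> nat" where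
  "M c l q = Max {card C | C. frameproof c {0..<q} l (C :: nat list set)}"

definition prime_power :: "nat \<Rightarrow> bool" where
  "prime_power n \<longleftrightarrow> (\<exists>p k. prime p \<and> k \<ge> 1 \<and> n = p ^ k)"

end

theory Submission
  imports Defs "HOL-Computational_Algebra.Polynomial" "HOL-Library.FuncSet"
begin

text \<open>Upper bound: call a set of coordinates own for a codeword \<open>x\<close> if no other codeword agrees with
  \<open>x\<close> on it. At most \<open>(c + 2) q\<close> codewords have an own singleton. For any other codeword two disjoint
  non-own pairs, completed by singletons, would be a cover by \<open>c\<close> non-own sets, which the frameproof
  property forbids; so the non-own pairs intersect pairwise, there are at most \<open>c + 1\<close> of them, and at
  least \<open>c (c + 1) / 2\<close> pairs are own. Each of the \<open>(c + 1) (c + 2) / 2\<close> pairs is own for at most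
  \<open>q\<^sup>2\<close> codewords.

  Lower bound: the lines of the affine plane of order \<open>c + 1\<close> that avoid the origin give
  \<open>c (c + 2)\<close> words of length \<open>c + 2\<close>, each with at most one entry \<open>0\<close>, two of which agree in at
  most one place. Inflating the \<open>c\<close> nonzero symbols by \<open>m\<close>, where \<open>m\<close> is coprime to \<open>(c + 1)!\<close>, gives
  \<open>c (c + 2) m\<^sup>2\<close> words over \<open>1 + c m\<close> symbols. Among \<open>c\<close> codewords that cover a codeword \<open>x\<close>, one
  agrees with \<open>x\<close> in two of its at least \<open>c + 1\<close> nonzero places, and this forces it to equal \<open>x\<close>.\<close>

subsection \<open>Prime ideals and the Frobenius map\<close>

text \<open>Rings and ideals are plain sets inside an ambient ring. Field arithmetic later becomes
  congruence modulo a prime ideal, so no quotient type has to be built.\<close>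

definition subring_of :: "'a::comm_ring_1 set \<Rightarrow> bool" where
  "subring_of R \<longleftrightarrow> 1 \<in> R \<and> (\<forall>a\<in>R. \<forall>b\<in>R. a - b \<in> R \<and> a * b \<in> R)"

definition ideal_of :: "'a::comm_ring_1 set \<Rightarrow> 'a set \<Rightarrow> bool" where
  "ideal_of R I \<longleftrightarrow> I \<subseteq> R \<and> 0 \<in> I \<and> (\<forall>a\<in>I. \<forall>b\<in>I. a - b \<in> I) \<and> (\<forall>r\<in>R. \<forall>a\<in>I. r * a \<in> I)"

lemma subring_of_closed:
  assumes "subring_of R"
  shows "0 \<in> R" "1 \<in> R"
    and "a \<in> R \<Longrightarrow> b \<in> R \<Longrightarrow> a - b \<in> R"
    and "a \<in> R \<Longrightarrow> b \<in> R \<Longrightarrow> a + b \<in> R"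
    and "a \<in> R \<Longrightarrow> b \<in> R \<Longrightarrow> a * b \<in> R"
    and "a \<in> R \<Longrightarrow> a ^ k \<in> R"
    and "of_nat k \<in> R"
proof -
  show z: "0 \<in> R" and o: "1 \<in> R"
    using assms unfolding subring_of_def by (metis diff_self, blast)
  show d: "a - b \<in> R" if "a \<in> R" "b \<in> R" for a b
    using assms that by (auto simp: subring_of_def)
  show p: "a + b \<in> R" if "a \<in> R" "b \<in> R" for a b
    using d[OF that(1) d[OF z that(2)]] by simp
  show m: "a * b \<in> R" if "a \<in> R" "b \<in> R" for a b
    using assms that by (auto simp: subring_of_def)
  show "a ^ k \<in> R" if "a \<in> R"
    using that by (induction k) (auto intro: o m)
  show "of_nat k \<in> R"
    by (induction k) (auto intro: z o p)
qed

lemma ideal_of_closed: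
  assumes "ideal_of R I"
  shows "a \<in> I \<Longrightarrow> a \<in> R" "0 \<in> I"
    and "a \<in> I \<Longrightarrow> b \<in> I \<Longrightarrow> a - b \<in> I"
    and "a \<in> I \<Longrightarrow> b \<in> I \<Longrightarrow> a + b \<in> I"
    and "r \<in> R \<Longrightarrow> a \<in> I \<Longrightarrow> r * a \<in> I"
    and "(\<And>x. x \<in> S \<Longrightarrow> f x \<in> I) \<Longrightarrow> sum f S \<in> I"
proof -
  show "a \<in> I \<Longrightarrow> a \<in> R" and z: "0 \<in> I"
    and "r \<in> R \<Longrightarrow> a \<in> I \<Longrightarrow> r * a \<in> I"
    using assms by (auto simp: ideal_of_def)
  show d: "a - b \<in> I" if "a \<in> I" "b \<in> I" for a b
    using assms that by (auto simp: ideal_of_def)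
  show p: "a + b \<in> I" if "a \<in> I" "b \<in> I" for a b
    using d[OF that(1) d[OF z that(2)]] by simp
  show "(\<And>x. x \<in> S \<Longrightarrow> f x \<in> I) \<Longrightarrow> sum f S \<in> I"
    by (induction S rule: infinite_finite_induct) (auto intro: z p)
qed

text \<open>By Zorn there is an ideal maximal among those that contain \<open>I\<close> and miss
  \<open>1\<close>, and maximality makes it prime.\<close>

lemma prime_ideal_exists:
  assumes R: "subring_of R" and I: "ideal_of R I" "1 \<notin> I"
  obtains P where "ideal_of R P" "I \<subseteq> P" "1 \<notin> P"
    "\<And>a b. a \<in> R \<Longrightarrow> b \<in> R \<Longrightarrow> a * b \<in> P \<Longrightarrow> a \<in> P \<or> b \<in> P"
proof -
  define \<A> where "\<A> = {J. ideal_of R J \<and> I \<subseteq> J \<and> 1 \<notin> J}"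
  have "\<exists>P\<in>\<A>. \<forall>X\<in>\<A>. P \<subseteq> X \<longrightarrow> X = P"
  proof (rule subset_Zorn_nonempty)
    show "\<A> \<noteq> {}" using I by (auto simp: \<A>_def)
    fix C assume C: "C \<noteq> {}" "subset.chain \<A> C"
    then obtain J0 where J0: "J0 \<in> C" by blast
    have id: "ideal_of R J" "I \<subseteq> J" "1 \<notin> J" if "J \<in> C" for J
      using C that by (auto simp: \<A>_def subset_chain_def)
    have "a - b \<in> \<Union>C" if ab: "a \<in> \<Union>C" "b \<in> \<Union>C" for a b
    proof -
      obtain J K where JK: "a \<in> J" "J \<in> C" "b \<in> K" "K \<in> C" using ab by blast
      then have "J \<subseteq> K \<or> K \<subseteq> J" using C by (auto simp: subset_chain_def)
      then show ?thesis using JK ideal_of_closed(3)[OF id(1)] by blast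
    qed
    moreover have "r * a \<in> \<Union>C" if "r \<in> R" "a \<in> \<Union>C" for r a
      using that ideal_of_closed(5)[OF id(1)] by blast
    moreover have "\<Union>C \<subseteq> R" "0 \<in> \<Union>C"
      using ideal_of_closed(1,2)[OF id(1)] J0 by blast+
    ultimately have "ideal_of R (\<Union>C)" unfolding ideal_of_def by blast
    then show "\<Union>C \<in> \<A>" using id(2,3) J0 by (auto simp: \<A>_def)
  qed
  then obtain P where P: "P \<in> \<A>" and max: "\<And>X. X \<in> \<A> \<Longrightarrow> P \<subseteq> X \<Longrightarrow> X = P" by blast
  have iP: "ideal_of R P" "I \<subseteq> P" "1 \<notin> P" using P by (auto simp: \<A>_def)
  note Pc = ideal_of_closed[OF iP(1)] and Rc = subring_of_closed[OF R]
  have "b \<in> P" if ab: "a \<in> R" "b \<in> R" "a * b \<in> P" "a \<notin> P" for a b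
  proof -
    \<comment> \<open>The ideal generated by \<open>P\<close> and \<open>a\<close>. Maximality
      forces \<open>1 \<in> J\<close>, and multiplying \<open>1 = r * a + m\<close> by
      \<open>b\<close> puts \<open>b\<close> into \<open>P\<close>.\<close>
    define J where "J = {r * a + m | r m. r \<in> R \<and> m \<in> P}"
    have "ideal_of R J"
      unfolding ideal_of_def
    proof (intro conjI ballI)
      show "J \<subseteq> R" using ab Rc(4,5) Pc(1) by (auto simp: J_def)
      show "0 \<in> J" unfolding J_def using Rc(1) Pc(2) by force
    next
      fix x y assume "x \<in> J" "y \<in> J"
      then obtain r m s n where "x = r * a + m" "y = s * a + n" "r \<in> R" "s \<in> R" "m \<in> P" "n \<in> P"
        by (auto simp: J_def)
      then have "x - y = (r - s) * a + (m - n)" "r - s \<in> R" "m - n \<in> P"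
        using Rc(3) Pc(3) by (auto simp: algebra_simps)
      then show "x - y \<in> J" unfolding J_def by blast
    next
      fix s x assume "s \<in> R" "x \<in> J"
      then obtain r m where rm: "x = r * a + m" "r \<in> R" "m \<in> P" by (auto simp: J_def)
      then have "s * x = (s * r) * a + s * m" by (simp add: algebra_simps)
      then show "s * x \<in> J" unfolding J_def using rm \<open>s \<in> R\<close> Rc(5) Pc(5) by blast
    qed
    moreover have sub: "P \<subseteq> J" using Rc(1) by (force simp: J_def)
    moreover have aJ: "a \<in> J" using Rc(2) Pc(2) by (force simp: J_def)
    ultimately have "1 \<in> J" using max[of J] iP(2) ab(4) by (auto simp: \<A>_def)
    then obtain r m where rm: "1 = r * a + m" "r \<in> R" "m \<in> P" by (auto simp: J_def)
    have "b = (r * a + m) * b" using rm(1) by (metis mult_1)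
    also have "\<dots> = r * (a * b) + b * m" by (simp add: algebra_simps)
    finally have "b = r * (a * b) + b * m" .
    then show "b \<in> P" using rm ab Pc(4,5) by metis
  qed
  then show thesis using that iP by blast
qed

text \<open>The prime \<open>p\<close> divides all middle binomial coefficients, so they vanish
  modulo an ideal that contains \<open>p\<close>. Iterating gives the exponent
  \<open>p ^ k\<close>.\<close>

lemma frobenius_ideal:
  fixes R :: "'a::comm_ring_1 set"
  assumes R: "subring_of R" and I: "ideal_of R I" and p: "prime p" "of_nat p \<in> I"
    and ab: "a \<in> R" "b \<in> R"
  shows "(a + b) ^ (p ^ k) - a ^ (p ^ k) - b ^ (p ^ k) \<in> I"
proof -
  note Ic = ideal_of_closed[OF I] and Rc = subring_of_closed[OF R]
  have 1: "(a + b) ^ p - a ^ p - b ^ p \<in> I" if ab: "a \<in> R" "b \<in> R" for a b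
  proof -
    have "p > 0" using p(1) prime_gt_0_nat by blast
    then have "{..p} = insert 0 (insert p {0<..<p})" by auto
    then have "(a + b) ^ p - a ^ p - b ^ p = (\<Sum>i\<in>{0<..<p}. of_nat (p choose i) * a ^ i * b ^ (p - i))"
      using \<open>p > 0\<close> by (simp add: binomial_ring)
    also have "\<dots> \<in> I"
    proof (rule Ic(6))
      fix i assume i: "i \<in> {0<..<p}"
      then have "p dvd (p choose i)" using p(1) by (intro dvd_choose_prime) auto
      then obtain d where "p choose i = p * d" by blast
      then have "of_nat (p choose i) * a ^ i * b ^ (p - i) = (of_nat d * a ^ i * b ^ (p - i)) * of_nat p"
        by (simp add: algebra_simps)
      also have "\<dots> \<in> I" using Rc(5,6,7) ab p(2) by (intro Ic(5)) auto
      finally show "of_nat (p choose i) * a ^ i * b ^ (p - i) \<in> I" .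
    qed
    finally show ?thesis .
  qed
  show ?thesis
  proof (induction k)
    case 0
    then show ?case using Ic(2) by simp
  next
    case (Suc k)
    define A B m where "A = a ^ (p ^ k)" and "B = b ^ (p ^ k)" and "m = (a + b) ^ (p ^ k) - A - B"
    have m: "m \<in> I" using Suc by (simp add: m_def A_def B_def)
    have AB: "A \<in> R" "B \<in> R" using ab Rc(6) by (auto simp: A_def B_def)
    have mp: "m ^ p \<in> I"
      using m Ic(5)[OF Rc(6)[OF Ic(1)[OF m]] m, of "p - 1"] prime_gt_0_nat[OF p(1)]
      by (metis power_minus_mult)
    have "(a + b) ^ (p ^ k) = (A + B) + m" by (simp add: m_def)
    then have "(a + b) ^ (p ^ Suc k) - a ^ (p ^ Suc k) - b ^ (p ^ Suc k)
       = ((A + B) + m) ^ p - A ^ p - B ^ p"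
      by (simp only: A_def B_def power_Suc2 power_mult)
    \<comment> \<open>The case of exponent \<open>p\<close> is used twice: first to split off the
      error term \<open>m\<close>, then to split \<open>A + B\<close>.\<close>
    also have "\<dots> = (((A + B) + m) ^ p - (A + B) ^ p - m ^ p) + ((A + B) ^ p - A ^ p - B ^ p) + m ^ p"
      by simp
    also have "\<dots> \<in> I"
      using 1[OF Rc(4)[OF AB] Ic(1)[OF m]] 1[OF AB] mp Ic(4) by blast
    finally show ?case .
  qed
qed

subsection \<open>The finite field of order \<open>p ^ k\<close> as a quotient of \<open>\<int>[\<zeta>]\<close>\<close>

text \<open>For \<open>n > 0\<close> this is the ring \<open>\<int>[\<zeta>]\<close> of the
  \<open>n\<close>-th roots of unity. Products of roots are roots, so the additive group they
  generate is already a ring, and inductions only have to treat roots and differences.\<close>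

inductive_set roots_ring :: "nat \<Rightarrow> complex set" for n where
  root: "z ^ n = 1 \<Longrightarrow> z \<in> roots_ring n"
| diff: "a \<in> roots_ring n \<Longrightarrow> b \<in> roots_ring n \<Longrightarrow> a - b \<in> roots_ring n"

lemma subring_of_roots_ring: "subring_of (roots_ring n)"
proof -
  have 1: "z * b \<in> roots_ring n" if "z ^ n = 1" "b \<in> roots_ring n" for z b
    using that(2,1)
    by induction (auto intro: roots_ring.intros simp: power_mult_distrib right_diff_distrib)
  have "a * b \<in> roots_ring n" if "a \<in> roots_ring n" "b \<in> roots_ring n" for a b
    using that by induction (auto intro: roots_ring.intros 1 simp: left_diff_distrib)
  then show ?thesis
    by (auto simp: subring_of_def intro: roots_ring.intros)
qed

text \<open>Basis extension over \<open>\<rat>\<close>: the set \<open>{1}\<close> is independent in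
  \<open>complex\<close>, so a linear map may be prescribed at \<open>1\<close>.\<close>

lemma rational_functional:
  obtains \<phi> :: "complex \<Rightarrow> rat" where
    "\<phi> 1 = 1" "\<And>x y. \<phi> (x - y) = \<phi> x - \<phi> y" "\<And>r x. \<phi> (of_rat r * x) = r * \<phi> x"
proof -
  interpret vector_space_pair "\<lambda>(r::rat) (x::complex). of_rat r * x" "(*) :: rat \<Rightarrow> rat \<Rightarrow> rat"
    by unfold_locales (auto simp: algebra_simps of_rat_add of_rat_mult)
  have "vs1.independent {1::complex}" by simp
  from linear_independent_extend[OF this, of "\<lambda>_. 1"] obtain g
    where g: "Vector_Spaces.linear (\<lambda>(r::rat) (x::complex). of_rat r * x) ((*) :: rat \<Rightarrow> rat \<Rightarrow> rat) g" "g 1 = 1"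
    by auto
  then show thesis using that linear_diff[OF g(1)] linear_scale[OF g(1)] by blast
qed

lemma rat_common_denominator:
  assumes "finite S"
  shows "\<exists>D::nat. D > 0 \<and> (\<forall>x\<in>S. of_nat D * (f x :: rat) \<in> \<int>)"
  using assms
proof induction
  case empty
  then show ?case by (intro exI[of _ 1]) auto
next
  case (insert x S)
  then obtain D where D: "D > 0" "\<forall>x\<in>S. of_nat D * f x \<in> \<int>" by blast
  obtain u v where uv: "quotient_of (f x) = (u, v)" by fastforce
  then have v: "v > 0" "f x = of_int u / of_int v"
    using quotient_of_denom_pos quotient_of_div by blast+
  show ?case
  proof (intro exI[of _ "D * nat v"] conjI ballI)
    show "D * nat v > 0" using D v by simp
    fix y assume y: "y \<in> insert x S"
    have nv: "of_nat (nat v) = (of_int v :: rat)" using v by simp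
    show "of_nat (D * nat v) * f y \<in> \<int>"
    proof (cases "y = x")
      case True
      then have "of_nat (D * nat v) * f y = of_int (int D * u)" using v nv by (simp add: field_simps)
      then show ?thesis by (metis Ints_of_int)
    next
      case False
      then have "of_nat D * f y \<in> \<int>" using y D by auto
      then have "of_int v * (of_nat D * f y) \<in> \<int>" by (rule Ints_mult[OF Ints_of_int])
      moreover have "of_nat (D * nat v) * f y = of_int v * (of_nat D * f y)"
        unfolding of_nat_mult nv by (simp only: mult_ac)
      ultimately show ?thesis by metis
    qed
  qed
qed

text \<open>A \<open>\<rat>\<close>-linear functional with value \<open>1\<close> at \<open>1\<close> has bounded denominators on the ring, so the ring
  cannot contain all the powers of \<open>1 / p\<close>.\<close>

lemma prime_not_unit_roots_ring:
  assumes "n > 0" "prime p"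
  shows "1 / of_nat p \<notin> roots_ring n"
proof
  assume H: "1 / of_nat p \<in> roots_ring n"
  obtain \<phi> :: "complex \<Rightarrow> rat" where phi: "\<phi> 1 = 1" "\<And>x y. \<phi> (x - y) = \<phi> x - \<phi> y"
    "\<And>r x. \<phi> (of_rat r * x) = r * \<phi> x"
    by (rule rational_functional) blast
  obtain D :: nat where D: "D > 0" "\<And>z. z ^ n = 1 \<Longrightarrow> of_nat D * \<phi> z \<in> \<int>"
    using rat_common_denominator[OF finite_roots_unity[of n], of \<phi>] assms(1) by auto
  have int: "of_nat D * \<phi> x \<in> \<int>" if "x \<in> roots_ring n" for x
    using that by induction (auto simp: D phi right_diff_distrib)
  \<comment> \<open>The exponent \<open>D\<close> is chosen because
    \<open>D < 2 ^ D \<le> p ^ D\<close>, which puts this supposed integer strictly between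
    \<open>0\<close> and \<open>1\<close>.\<close>
  have "of_nat D / of_nat p ^ D \<in> (\<int> :: rat set)"
  proof -
    have "\<phi> ((1 / of_nat p) ^ D) = \<phi> (of_rat (1 / of_nat p ^ D) * 1)"
      by (simp add: of_rat_divide of_rat_power power_divide)
    also have "\<dots> = 1 / of_nat p ^ D" by (subst phi(3)) (simp add: phi)
    finally have "\<phi> ((1 / of_nat p) ^ D) = 1 / of_nat p ^ D" .
    then show ?thesis
      using int[OF subring_of_closed(6)[OF subring_of_roots_ring H], of D] by simp
  qed
  then obtain z where z: "of_nat D / of_nat p ^ D = (of_int z :: rat)" by (auto elim: Ints_cases)
  have "D < 2 ^ D" by (rule less_exp)
  also have "(2::nat) ^ D \<le> p ^ D" using assms(2) by (intro power_mono prime_ge_2_nat) auto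
  finally have "D < p ^ D" .
  then have lt: "of_nat D < (of_nat p ^ D :: rat)" by (metis of_nat_less_iff of_nat_power)
  have "p > 0" using assms(2) prime_gt_0_nat by blast
  then have "0 < (of_int z :: rat)" "(of_int z :: rat) < 1"
    unfolding z[symmetric] using D lt by auto
  then show False by simp
qed

text \<open>Both sides are monic polynomials of degree \<open>n + 1\<close> in \<open>x\<close> that
  vanish at the same \<open>n + 1\<close> points.\<close>

lemma power_diff_self_eq_prod:
  fixes x :: complex
  assumes "n > 0"
  shows "x ^ Suc n - x = (\<Prod>t\<in>insert 0 {z. z ^ n = 1}. x - t)"
proof -
  let ?T = "insert 0 {z::complex. z ^ n = 1}"
  have fin: "finite ?T" using assms by (simp add: finite_roots_unity)
  have card: "card ?T = Suc n"
    using assms by (subst card_insert_disjoint) (auto simp: finite_roots_unity card_roots_unity_eq zero_power)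
  have deg: "degree (\<Prod>t\<in>?T. [:- t, 1:]) = Suc n"
    using fin card by (subst degree_prod_eq_sum_degree) auto
  have "monom 1 (Suc n) - monom 1 1 = (\<Prod>t\<in>?T. [:- t, 1:])"
  proof (rule poly_eqI_degree_lead_coeff[where A = ?T and n = "Suc n"])
    have "lead_coeff (\<Prod>t\<in>?T. [:- t, 1:]) = 1" by (simp only: lead_coeff_prod) simp
    then show "coeff (monom 1 (Suc n) - monom 1 1) (Suc n) = coeff (\<Prod>t\<in>?T. [:- t, 1:]) (Suc n)"
      using assms deg by simp
    show "degree (monom (1::complex) (Suc n) - monom 1 1) \<le> Suc n"
      by (rule degree_diff_le) (auto simp: degree_monom_eq)
    show "poly (monom 1 (Suc n) - monom 1 1) z = poly (\<Prod>t\<in>?T. [:- t, 1:]) z" if "z \<in> ?T" for z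
    proof -
      have "poly (\<Prod>t\<in>?T. [:- t, 1:]) z = 0"
        unfolding poly_prod using fin that by (subst prod_zero_iff) auto
      then show ?thesis using that by (auto simp: poly_monom)
    qed
  qed (use card deg in auto)
  then have "poly (monom 1 (Suc n) - monom 1 1) x = poly (\<Prod>t\<in>?T. [:- t, 1:]) x" by simp
  then show ?thesis by (simp add: poly_monom poly_prod del: prod.insert)
qed

lemma prime_ideal_prod:
  assumes R: "subring_of R" and P: "1 \<notin> P"
    "\<And>a b. a \<in> R \<Longrightarrow> b \<in> R \<Longrightarrow> a * b \<in> P \<Longrightarrow> a \<in> P \<or> b \<in> P"
    and S: "finite S" "\<And>s. s \<in> S \<Longrightarrow> f s \<in> R" "prod f S \<in> P"
  shows "\<exists>s\<in>S. f s \<in> P"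
proof -
  note Rc = subring_of_closed[OF R]
  have "prod f S \<in> R \<and> (prod f S \<in> P \<longrightarrow> (\<exists>s\<in>S. f s \<in> P))"
    using S(1,2)
  proof induction
    case (insert x S)
    then show ?case using P(2)[of "f x" "prod f S"] Rc(5)[of "f x" "prod f S"] by auto
  qed (use P(1) Rc(2) in auto)
  then show ?thesis using S(3) by blast
qed

text \<open>Modulo a prime ideal over \<open>p\<close>, the set \<open>T\<close> of \<open>0\<close> and the \<open>n\<close>-th roots of unity, \<open>n = p ^ k - 1\<close>,
  represents every class: \<open>\<Prod>t\<in>T. x - t\<close> equals \<open>x ^ (p ^ k) - x\<close>, which lies in the ideal by Frobenius.
  The classes are distinct, since for a root of unity \<open>z \<noteq> 1\<close> congruent to \<open>1\<close> the vanishing sum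
  \<open>\<Sum>i<n. z ^ i\<close> would be congruent to \<open>n\<close>, that is, to \<open>-1\<close>.\<close>

lemma finite_field_transversal:
  assumes "prime_power Q"
  obtains R :: "complex set" and P T where "subring_of R" "ideal_of R P"
    "\<And>a b. a \<in> R \<Longrightarrow> b \<in> R \<Longrightarrow> a * b \<in> P \<Longrightarrow> a \<in> P \<or> b \<in> P"
    "T \<subseteq> R" "0 \<in> T" "finite T" "card T = Q" "\<And>x. x \<in> R \<Longrightarrow> \<exists>!t. t \<in> T \<and> x - t \<in> P"
proof -
  obtain p k where pk: "prime p" "k \<ge> 1" "Q = p ^ k" using assms by (auto simp: prime_power_def)
  define n where "n = Q - 1"
  have "p \<ge> 2" using pk prime_ge_2_nat by blast
  then have "Q \<ge> 2" using pk self_le_power[of p k] by auto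
  then have n: "n > 0" "Q = Suc n" by (auto simp: n_def)
  define R where "R = roots_ring n"
  have R: "subring_of R" unfolding R_def by (rule subring_of_roots_ring)
  note Rc = subring_of_closed[OF R]
  \<comment> \<open>The principal ideal of \<open>p\<close>. It is proper because
    \<open>1 / p\<close> lies outside the ring, so a prime ideal \<open>P\<close> contains
    it.\<close>
  define I where "I = (\<lambda>r. of_nat p * r) ` R"
  have I: "ideal_of R I"
    unfolding ideal_of_def
  proof (intro conjI ballI)
    show "I \<subseteq> R" using Rc(5,7) by (auto simp: I_def)
    show "0 \<in> I" using Rc(1) by (force simp: I_def)
    show "a - b \<in> I" if "a \<in> I" "b \<in> I" for a b
      using that Rc(3) by (auto simp: I_def right_diff_distrib[symmetric])
    show "r * a \<in> I" if ra: "r \<in> R" "a \<in> I" for r a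
    proof -
      obtain s where "a = of_nat p * s" "s \<in> R" using ra by (auto simp: I_def)
      then have "r * a = of_nat p * (r * s)" "r * s \<in> R" using ra Rc(5) by auto
      then show ?thesis by (auto simp: I_def)
    qed
  qed
  have "1 \<notin> I"
  proof
    assume "1 \<in> I"
    then obtain r where "1 = of_nat p * r" "r \<in> R" by (auto simp: I_def)
    moreover from this have "r = 1 / of_nat p"
      using pk(1) by (auto simp: nonzero_eq_divide_eq mult.commute)
    ultimately show False using prime_not_unit_roots_ring[OF n(1) pk(1)] by (simp add: R_def)
  qed
  then obtain P where P: "ideal_of R P" "I \<subseteq> P" "1 \<notin> P"
    "\<And>a b. a \<in> R \<Longrightarrow> b \<in> R \<Longrightarrow> a * b \<in> P \<Longrightarrow> a \<in> P \<or> b \<in> P"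
    using prime_ideal_exists[OF R I] by blast
  note Pc = ideal_of_closed[OF P(1)]
  have pP: "of_nat p \<in> P" using P(2) Rc(2) by (force simp: I_def)
  define T where "T = insert 0 {z::complex. z ^ n = 1}"
  have T: "finite T" "card T = Q" "T \<subseteq> R"
    using n Rc(1) by (auto simp: T_def R_def finite_roots_unity card_insert_if card_roots_unity_eq zero_power
        intro: roots_ring.root)
  have fermat: "x ^ Q - x \<in> P" if "x \<in> R" for x
    using that unfolding R_def
  proof induction
    case (root z)
    then show ?case using n Pc(2) by simp
  next
    case (diff a b)
    then have "a - b \<in> R" "b \<in> R" using R_def Rc(3) by auto
    \<comment> \<open>Frobenius is applied to the sum \<open>(a - b) + b\<close>, which avoids the
      sign \<open>(- 1) ^ Q\<close>.\<close>
    from frobenius_ideal[OF R P(1) pk(1) pP this, of k]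
    have f: "a ^ Q - (a - b) ^ Q - b ^ Q \<in> P" by (simp add: pk(3))
    have "(a - b) ^ Q - (a - b) = (a ^ Q - a) - (b ^ Q - b) - (a ^ Q - (a - b) ^ Q - b ^ Q)" by simp
    also have "\<dots> \<in> P" using f diff Pc(3) by blast
    finally show ?case .
  qed
  have ex: "\<exists>t\<in>T. x - t \<in> P" if "x \<in> R" for x
  proof (rule prime_ideal_prod[OF R P(3,4) T(1)])
    show "(\<Prod>t\<in>T. x - t) \<in> P"
      using fermat[OF that] power_diff_self_eq_prod[OF n(1), of x] n(2) by (simp add: T_def)
  qed (use that T Rc(3) in auto)
  have nP: "of_nat n \<notin> P"
  proof
    assume a: "of_nat n \<in> P"
    have "of_nat Q = of_nat (p ^ (k - 1)) * (of_nat p :: complex)"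
      using pk by (cases k) auto
    then have "of_nat Q \<in> P" using Pc(5)[OF Rc(7) pP] by metis
    then have "of_nat Q - of_nat n \<in> P" using a Pc(3) by blast
    then show False using P(3) n by simp
  qed
  have unity: "z = 1" if z: "z ^ n = 1" "z - 1 \<in> P" for z
  proof (rule ccontr)
    assume "z \<noteq> 1"
    then have "(\<Sum>i<n. z ^ i) = 0" using z(1) by (simp add: geometric_sum)
    then have "of_nat n = - (\<Sum>i<n. z ^ i - 1)" by (simp add: sum_subtractf)
    moreover have "(\<Sum>i<n. z ^ i - 1) \<in> P"
    proof (rule Pc(6))
      fix i
      have zR: "z \<in> R" using z by (auto simp: R_def intro: roots_ring.root)
      show "z ^ i - 1 \<in> P"
      proof (induction i)
        case 0
        then show ?case using Pc(2) by simp
      next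
        case (Suc i)
        have "z ^ Suc i - 1 = z * (z ^ i - 1) + (z - 1)" by (simp add: algebra_simps)
        then show ?case using Pc(4)[OF Pc(5)[OF zR Suc] z(2)] by metis
      qed
    qed
    ultimately have "of_nat n \<in> P" using Pc(3)[OF Pc(2)] by (metis diff_0)
    then show False using nP by blast
  qed
  have no0: "t \<notin> P" if "t ^ n = 1" for t
  proof
    assume "t \<in> P"
    then have "t ^ (n - 1) * t \<in> P" using Pc(1,5) Rc(6) by blast
    then show False using that P(3) power_minus_mult[OF n(1), of t] by simp
  qed
  have inj: "s = t" if st: "s \<in> T" "t \<in> T" "s - t \<in> P" for s t
  proof (cases "s = 0 \<or> t = 0")
    case True
    then show ?thesis using st no0 Pc(3)[OF Pc(2), of "s - t"] by (auto simp: T_def)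
  next
    case False
    then have r: "s ^ n = 1" "t ^ n = 1" "s \<noteq> 0" "t \<noteq> 0" using st by (auto simp: T_def)
    \<comment> \<open>Multiplying by \<open>inverse t\<close> reduces two congruent roots to the
      root \<open>s / t\<close> congruent to \<open>1\<close>.\<close>
    have "inverse t \<in> R" using r by (auto simp: R_def power_inverse intro: roots_ring.root)
    then have "inverse t * (s - t) \<in> P" using st Pc(5) by blast
    moreover have "inverse t * (s - t) = s / t - 1" using r by (simp add: field_simps)
    moreover have "(s / t) ^ n = 1" using r by (simp add: power_divide)
    ultimately have "s / t = 1" using unity by metis
    then show ?thesis using r by simp
  qed
  have "\<exists>!t. t \<in> T \<and> x - t \<in> P" if "x \<in> R" for x
  proof -
    obtain t where t: "t \<in> T" "x - t \<in> P" using ex[OF \<open>x \<in> R\<close>] by blast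
    moreover have "s = t" if "s \<in> T" "x - s \<in> P" for s
      using inj[of s t] Pc(3)[OF t(2) that(2)] that(1) t(1) by simp
    ultimately show ?thesis by blast
  qed
  then show thesis using that[OF R P(1,4) T(3) _ T(1,2)] by (auto simp: T_def)
qed

subsection \<open>Orthogonal arrays and the lower bound\<close>

text \<open>The word of \<open>(a, b)\<close> lists the values of the polynomial
  \<open>a + b * X\<close> at the \<open>Q\<close> field elements, followed by the slope
  \<open>b\<close> in column \<open>Q\<close>. Two columns determine such a polynomial.\<close>

lemma orthogonal_array_exists:
  assumes "prime_power Q"
  obtains f :: "nat \<Rightarrow> nat \<Rightarrow> nat \<Rightarrow> nat" where
    "\<And>a b j. f a b j < Q" "\<And>j. f 0 0 j = 0"
    "\<And>a b a' b' i j. a < Q \<Longrightarrow> b < Q \<Longrightarrow> a' < Q \<Longrightarrow> b' < Q \<Longrightarrow> i \<le> Q \<Longrightarrow> j \<le> Q \<Longrightarrow> i \<noteq> j \<Longrightarrow>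
       f a b i = f a' b' i \<Longrightarrow> f a b j = f a' b' j \<Longrightarrow> a = a' \<and> b = b'"
proof -
  obtain R :: "complex set" and P T where R: "subring_of R" and P: "ideal_of R P"
    and prime: "\<And>a b. a \<in> R \<Longrightarrow> b \<in> R \<Longrightarrow> a * b \<in> P \<Longrightarrow> a \<in> P \<or> b \<in> P"
    and T: "T \<subseteq> R" "0 \<in> T" "finite T" "card T = Q"
    and uniq: "\<And>x. x \<in> R \<Longrightarrow> \<exists>!t. t \<in> T \<and> x - t \<in> P"
    using finite_field_transversal[OF assms] by blast
  note Rc = subring_of_closed[OF R] and Pc = ideal_of_closed[OF P]
  have Q: "Q > 0" using T card_gt_0_iff by blast
  have cT: "card (T - {0}) = Q - 1" using T by simp
  obtain e0 where e0: "bij_betw e0 {1..Q - 1} (T - {0})"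
    using ex_bij_betw_nat_finite_1[of "T - {0}"] T(3) unfolding cT by blast
  \<comment> \<open>The enumeration of \<open>T\<close> is normalised at \<open>0\<close>, so that
    the zero polynomial yields the zero word.\<close>
  define e where "e = e0(0 := 0)"
  have e_0: "e 0 = 0" by (simp add: e_def)
  have "bij_betw e {1..Q - 1} (T - {0})"
    using e0 by (subst bij_betw_cong[of _ e e0]) (auto simp: e_def)
  then have "bij_betw e ({1..Q - 1} \<union> {0}) ((T - {0}) \<union> {e 0})"
    by (intro notIn_Un_bij_betw) (auto simp: e_0)
  moreover have "{1..Q - 1} \<union> {0} = {0..<Q}" using Q by auto
  moreover have "(T - {0}) \<union> {e 0} = T" using T(2) by (auto simp: e_0)
  ultimately have e: "bij_betw e {0..<Q} T" by simp
  have eR: "e i \<in> R" if "i < Q" for i using e that T(1) by (auto simp: bij_betw_def)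
  have e_inj: "i = j" if "i < Q" "j < Q" "e i - e j \<in> P" for i j
  proof -
    have "e i \<in> T" "e j \<in> T" using e that by (auto simp: bij_betw_def)
    moreover have "e i - e i \<in> P" using Pc(2) by simp
    ultimately have "e i = e j" using uniq[OF eR[OF that(1)]] that(3) by blast
    then show ?thesis using inj_onD[OF bij_betw_imp_inj_on[OF e]] that(1,2) by simp
  qed
  define cls where "cls x = (SOME i. i < Q \<and> x - e i \<in> P)" for x
  have cls: "cls x < Q" "x - e (cls x) \<in> P" if "x \<in> R" for x
  proof -
    obtain t where "t \<in> T" "x - t \<in> P" using uniq[OF \<open>x \<in> R\<close>] by blast
    then have "\<exists>i. i < Q \<and> x - e i \<in> P" using e by (force simp: bij_betw_def)
    from someI_ex[OF this] show "cls x < Q" "x - e (cls x) \<in> P" by (auto simp: cls_def)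
  qed
  have cls_eq: "x - y \<in> P" if "x \<in> R" "y \<in> R" "cls x = cls y" for x y
  proof -
    have "(x - e (cls x)) - (y - e (cls y)) \<in> P" using cls that Pc(3) by blast
    then show ?thesis using that by simp
  qed
  have cls_0: "cls 0 = 0"
    using cls[of 0] e_inj[of 0 "cls 0"] Rc(1) Q by (simp add: e_0)
  define f where "f a b j = (if a < Q \<and> b < Q \<and> j \<le> Q then
      (if j = Q then cls (e b) else cls (e a + e b * e j)) else 0)" for a b j
  have col: "e a + e b * e j \<in> R" if "a < Q" "b < Q" "j < Q" for a b j
    using that by (simp add: eR Rc(4,5))
  show thesis
  proof (rule that[of f])
    show "f a b j < Q" for a b j using Q cls(1) col eR by (auto simp: f_def)
    show "f 0 0 j = 0" for j using cls_0 by (auto simp: f_def e_0)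
    fix a b a' b' i j
    assume lt: "a < Q" "b < Q" "a' < Q" "b' < Q" "i \<le> Q" "j \<le> Q" "i \<noteq> j"
      and eq: "f a b i = f a' b' i" "f a b j = f a' b' j"
    have main: "a = a' \<and> b = b'" if b: "b = b'" and s: "s < Q" "f a b s = f a' b' s" for s
    proof -
      have "(e a + e b * e s) - (e a' + e b' * e s) \<in> P"
        using cls_eq[OF col col] s lt by (auto simp: f_def)
      then show ?thesis using b e_inj lt by simp
    qed
    have colQ: "b = b'" if "f a b Q = f a' b' Q"
      using cls_eq[OF eR eR] e_inj lt that by (auto simp: f_def)
    show "a = a' \<and> b = b'"
    proof (cases "i = Q \<or> j = Q")
      case True
      then have "f a b Q = f a' b' Q" using eq by auto
      moreover have "i < Q \<or> j < Q" using lt(5-7) by linarith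
      then have "\<exists>s<Q. f a b s = f a' b' s" using eq by blast
      ultimately show ?thesis using main colQ by blast
    next
      case False
      then have ij: "i < Q" "j < Q" using lt by auto
      have "(e a + e b * e s) - (e a' + e b' * e s) \<in> P" if "s = i \<or> s = j" for s
        using cls_eq[OF col col] ij lt eq that by (auto simp: f_def)
      \<comment> \<open>Subtracting the congruences in columns \<open>i\<close> and \<open>j\<close>
        cancels the constant terms and leaves a product, to which primality of \<open>P\<close>
        applies.\<close>
      then have "((e a + e b * e i) - (e a' + e b' * e i)) - ((e a + e b * e j) - (e a' + e b' * e j)) \<in> P"
        using Pc(3) by blast
      then have "(e b - e b') * (e i - e j) \<in> P" by (simp add: algebra_simps)
      then have "e b - e b' \<in> P \<or> e i - e j \<in> P"
        using prime eR Rc(3) lt ij by meson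
      then have "b = b'" using e_inj lt ij by blast
      then show ?thesis using main ij eq by blast
    qed
  qed
qed

section \<open>From the array to a frameproof code\<close>

text \<open>Pigeonhole: if at most \<open>c\<close> codewords cover \<open>x\<close>, one of them
  covers two of the more than \<open>c\<close> places of \<open>Z\<close>, and hence equals
  \<open>x\<close>.\<close>

lemma frameproofI_agreement:
  assumes "C \<subseteq> words F (c + 2)" "finite C"
    and "\<And>x. x \<in> C \<Longrightarrow> \<exists>Z. Z \<subseteq> {..<c + 2} \<and> card Z > c \<and>
      (\<forall>y\<in>C. \<forall>i\<in>Z. \<forall>j\<in>Z. i \<noteq> j \<longrightarrow> x ! i = y ! i \<longrightarrow> x ! j = y ! j \<longrightarrow> x = y)"
  shows "frameproof c F (c + 2) C"
  unfolding frameproof_def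
proof (intro conjI allI impI)
  fix Y assume Y: "Y \<subseteq> C \<and> card Y \<le> c"
  have "x \<in> Y" if x: "x \<in> desc F (c + 2) Y" "x \<in> C" for x
  proof -
    obtain Z where Z: "Z \<subseteq> {..<c + 2}" "card Z > c"
      "\<And>y i j. y \<in> C \<Longrightarrow> i \<in> Z \<Longrightarrow> j \<in> Z \<Longrightarrow> i \<noteq> j \<Longrightarrow> x ! i = y ! i \<Longrightarrow> x ! j = y ! j \<Longrightarrow> x = y"
      using assms(3)[OF x(2)] by metis
    have "\<forall>i\<in>Z. \<exists>y\<in>Y. x ! i = y ! i" using x Z(1) by (auto simp: desc_def)
    then obtain h where h: "\<And>i. i \<in> Z \<Longrightarrow> h i \<in> Y \<and> x ! i = h i ! i" by metis
    have "finite Y" using Y assms(2) finite_subset by blast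
    then have "card (h ` Z) \<le> card Y" using h by (intro card_mono) auto
    then have "card (h ` Z) < card Z" using Y Z(2) by linarith
    then have "\<not> inj_on h Z" by (rule pigeonhole)
    then obtain i j where ij: "i \<in> Z" "j \<in> Z" "i \<noteq> j" "h i = h j" by (auto simp: inj_on_def)
    then have "x = h i" using Z(3)[of "h i" i j] h Y by (metis subsetD)
    then show ?thesis using h ij by simp
  qed
  then show "desc F (c + 2) Y \<inter> C = Y" using Y assms(1) by (auto simp: desc_def)
qed (use assms in auto)

lemma frameproof_construction:
  assumes "c \<ge> 2" "prime_power (c + 1)" "m > 0" "coprime m (fact (c + 1))" "1 + c * m \<le> q"
  shows "\<exists>C. frameproof c {0..<q} (c + 2) C \<and> card C = c * (c + 2) * m\<^sup>2"
proof -
  define Q where "Q = c + 1"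
  obtain f :: "nat \<Rightarrow> nat \<Rightarrow> nat \<Rightarrow> nat" where
    f_lt: "\<And>a b j. f a b j < Q" and f_0: "\<And>j. f 0 0 j = 0"
    and f_inj: "\<And>a b a' b' i j. a < Q \<Longrightarrow> b < Q \<Longrightarrow> a' < Q \<Longrightarrow> b' < Q \<Longrightarrow> i \<le> Q \<Longrightarrow> j \<le> Q \<Longrightarrow> i \<noteq> j \<Longrightarrow>
       f a b i = f a' b' i \<Longrightarrow> f a b j = f a' b' j \<Longrightarrow> a = a' \<and> b = b'"
    using orthogonal_array_exists[of Q] assms(2) unfolding Q_def by blast
  \<comment> \<open>A word of the array other than the zero word has at most one entry \<open>0\<close>. That symbol is kept,
    and every other symbol is split into \<open>m\<close> copies, indexed by the line \<open>u + v * j\<close> modulo \<open>m\<close>.\<close>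
  define g where "g = (\<lambda>(a, b, u, v) j. if f a b j = 0 then 0 else 1 + (f a b j - 1) * m + (u + v * j) mod m)"
  define w where "w t = map (g t) [0..<c + 2]" for t
  define S where "S = {t. fst t < Q \<and> fst (snd t) < Q \<and> (fst t, fst (snd t)) \<noteq> (0, 0) \<and>
     fst (snd (snd t)) < m \<and> snd (snd (snd t)) < m}"
  have S_eq: "S = (\<lambda>((a, b), u, v). (a, b, u, v)) ` (({..<Q} \<times> {..<Q} - {(0, 0)}) \<times> {..<m} \<times> {..<m})"
    by (force simp: S_def)
  have "card S = (Q * Q - 1) * (m * m)"
    unfolding S_eq by (subst card_image) (auto simp: inj_on_def card_cartesian_product card_Diff_subset Q_def)
  also have "Q * Q - 1 = c * (c + 2)" by (simp add: Q_def)
  finally have cardS: "card S = c * (c + 2) * m\<^sup>2" by (simp add: power2_eq_square)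
  have finS: "finite S" unfolding S_eq by simp
  define Z where "Z t = {j. j < c + 2 \<and> g t j \<noteq> 0}" for t
  \<comment> \<open>Two agreements at nonzero places first identify the array word. The lines
    \<open>u + v * s\<close> modulo \<open>m\<close> then agree at \<open>i\<close> and
    \<open>j\<close>, and \<open>i - j\<close> is invertible modulo \<open>m\<close> because its
    absolute value divides \<open>(c + 1)!\<close>, so the lines coincide.\<close>
  have key: "t = t'" if t: "t \<in> S" "t' \<in> S" "i \<in> Z t" "j \<in> Z t" "i \<noteq> j"
      "g t i = g t' i" "g t j = g t' j" for t t' i j
  proof -
    obtain a b u v where T: "t = (a, b, u, v)" by (metis prod.exhaust)
    obtain a' b' u' v' where T': "t' = (a', b', u', v')" by (metis prod.exhaust)
    have dec: "f a b s = f a' b' s \<and> (u + v * s) mod m = (u' + v' * s) mod m"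
      if s: "g t s = g t' s" "s \<in> Z t" for s
    proof -
      have "g t s \<noteq> 0" "g t' s \<noteq> 0" using s by (simp_all add: Z_def)
      then have nz: "f a b s \<noteq> 0" "f a' b' s \<noteq> 0" by (auto simp: T T' g_def intro: gr0I)
      then have eq: "(f a b s - 1) * m + (u + v * s) mod m = (f a' b' s - 1) * m + (u' + v' * s) mod m"
        using s by (auto simp: T T' g_def)
      \<comment> \<open>Division by \<open>m\<close> recovers the array symbol, and the remainder is
        the index of the copy.\<close>
      then have "((f a b s - 1) * m + (u + v * s) mod m) div m = ((f a' b' s - 1) * m + (u' + v' * s) mod m) div m"
        by simp
      then have "f a b s - 1 = f a' b' s - 1" using assms(3) by simp
      then show ?thesis using eq nz by simp
    qed
    have "a = a' \<and> b = b'"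
    proof (rule f_inj)
      show "a < Q" "b < Q" "a' < Q" "b' < Q" using t(1,2) by (simp_all add: S_def T T')
      show "i \<le> Q" "j \<le> Q" using t(3,4) by (simp_all add: Z_def Q_def)
    qed (use dec t in blast)+
    moreover have uv: "u < m" "v < m" "u' < m" "v' < m" using t T T' by (auto simp: S_def)
    have di: "int m dvd (int u + int v * int i) - (int u' + int v' * int i)"
      and dj: "int m dvd (int u + int v * int j) - (int u' + int v' * int j)"
      using dec[OF t(6,3)] dec[OF t(7,4)]
      by (metis mod_eq_dvd_iff of_nat_add of_nat_mult of_nat_mod)+
    have "int m dvd (int v - int v') * (int i - int j)"
      using dvd_diff[OF di dj] by (simp add: algebra_simps)
    moreover have "coprime (int m) (int i - int j)"
    proof -
      have "nat \<bar>int i - int j\<bar> dvd fact (c + 1)"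
        using t by (intro dvd_fact) (auto simp: Z_def)
      then have "coprime m (nat \<bar>int i - int j\<bar>)" using assms(4) coprime_divisors dvd_refl by blast
      then have "coprime (int m) (int (nat \<bar>int i - int j\<bar>))" by (simp only: coprime_int_iff)
      then show ?thesis by simp
    qed
    ultimately have "int m dvd int v - int v'" by (simp add: coprime_dvd_mult_left_iff)
    then have v: "v = v'" using uv by (metis mod_eq_dvd_iff mod_less of_nat_eq_iff zmod_int)
    then have "int m dvd int u - int u'" using di by simp
    then have u: "u = u'" using uv by (metis mod_eq_dvd_iff mod_less of_nat_eq_iff zmod_int)
    show ?thesis using \<open>a = a' \<and> b = b'\<close> u v T T' by simp
  qed
  \<comment> \<open>An entry \<open>0\<close> is an agreement with the zero word of the array, and
    two of them would force \<open>(a, b) = (0, 0)\<close>, which \<open>S\<close> excludes.\<close>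
  have cardZ: "card (Z t) > c" if "t \<in> S" for t
  proof (rule ccontr)
    obtain a b u v where T: "t = (a, b, u, v)" by (metis prod.exhaust)
    assume "\<not> card (Z t) > c"
    moreover have "Z t \<subseteq> {..<c + 2}" by (auto simp: Z_def)
    then have "card ({..<c + 2} - Z t) = c + 2 - card (Z t)" by (simp add: card_Diff_subset finite_subset)
    ultimately have "\<not> card ({..<c + 2} - Z t) \<le> Suc 0" by linarith
    then obtain i j where ij: "i < c + 2" "j < c + 2" "i \<noteq> j" "i \<notin> Z t" "j \<notin> Z t"
      by (subst (asm) card_le_Suc0_iff_eq) auto
    then have "f a b i = f 0 0 i" "f a b j = f 0 0 j" by (auto simp: Z_def T g_def f_0 split: if_splits)
    moreover have "a < Q" "b < Q" using that T by (auto simp: S_def)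
    ultimately have "a = 0 \<and> b = 0"
      using ij(1-3) f_inj[of a b 0 0 i j] by (simp add: Q_def)
    then show False using that T by (auto simp: S_def)
  qed
  have w_nth: "w t ! i = g t i" if "i < c + 2" for t i using that by (simp add: w_def del: upt_Suc)
  have sub: "w ` S \<subseteq> words {0..<q} (c + 2)"
  proof -
    have "g t j < q" for t j
    proof -
      obtain a b u v where T: "t = (a, b, u, v)" by (metis prod.exhaust)
      show ?thesis
      proof (cases "f a b j = 0")
        case True
        then show ?thesis using assms(5) by (simp add: T g_def)
      next
        case False
        then have "Suc (f a b j - 1) \<le> c" using f_lt[of a b j] by (simp add: Q_def)
        then have "Suc (f a b j - 1) * m \<le> c * m" by (rule mult_le_mono1)
        moreover have "(u + v * j) mod m < m" using assms(3) by simp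
        ultimately have "(f a b j - 1) * m + (u + v * j) mod m < c * m" by simp
        then show ?thesis using assms(5) False by (simp add: T g_def)
      qed
    qed
    then show ?thesis by (auto simp: words_def w_def)
  qed
  have fp: "frameproof c {0..<q} (c + 2) (w ` S)"
  proof (rule frameproofI_agreement[OF sub])
    fix x assume "x \<in> w ` S"
    then obtain t where t: "t \<in> S" "x = w t" by blast
    show "\<exists>Z. Z \<subseteq> {..<c + 2} \<and> card Z > c \<and>
      (\<forall>y\<in>w ` S. \<forall>i\<in>Z. \<forall>j\<in>Z. i \<noteq> j \<longrightarrow> x ! i = y ! i \<longrightarrow> x ! j = y ! j \<longrightarrow> x = y)"
    proof (intro exI[of _ "Z t"] conjI ballI impI)
      fix y i j assume "y \<in> w ` S" and ij: "i \<in> Z t" "j \<in> Z t" "i \<noteq> j" "x ! i = y ! i" "x ! j = y ! j"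
      then obtain t' where t': "t' \<in> S" "y = w t'" by blast
      have "i < c + 2" "j < c + 2" using ij by (auto simp: Z_def)
      then have "t = t'" using key[OF t(1) t'(1) ij(1,2,3)] ij(4,5) t t' w_nth by simp
      then show "x = y" using t t' by simp
    qed (use cardZ t in \<open>auto simp: Z_def\<close>)
  qed (use finS in simp)
  moreover have "inj_on w S"
  proof (rule inj_onI)
    fix t t' assume t: "t \<in> S" "t' \<in> S" "w t = w t'"
    then have "\<not> card (Z t) \<le> Suc 0" using cardZ[of t] assms(1) by linarith
    moreover have "finite (Z t)" by (simp add: Z_def)
    ultimately obtain i j where ij: "i \<in> Z t" "j \<in> Z t" "i \<noteq> j"
      using card_le_Suc0_iff_eq by blast
    then show "t = t'" using key[OF t(1,2) ij] w_nth t(3) by (simp add: Z_def) (metis w_nth)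
  qed
  then have "card (w ` S) = c * (c + 2) * m\<^sup>2" using cardS by (simp add: card_image)
  ultimately show ?thesis by blast
qed

subsection \<open>The upper bound\<close>

text \<open>Pairwise intersecting edges of a graph form a star, with at most \<open>l - 1\<close>
  edges, or lie in a triangle, with at most \<open>3 \<le> l - 1\<close> edges. In the second case
  an edge \<open>{a, b}\<close>, an edge missing \<open>a\<close> and an edge missing
  \<open>b\<close> span the triangle.\<close>

lemma intersecting_pairs_card_le:
  assumes l: "l \<ge> 4" and N: "\<And>e. e \<in> N \<Longrightarrow> e \<subseteq> {..<l} \<and> card e = 2"
    and int: "\<And>e e'. e \<in> N \<Longrightarrow> e' \<in> N \<Longrightarrow> e \<inter> e' \<noteq> {}"
  shows "card N \<le> l - 1"
proof (cases "\<exists>a<l. \<forall>e\<in>N. a \<in> e")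
  case True
  then obtain a where a: "a < l" "\<And>e. e \<in> N \<Longrightarrow> a \<in> e" by blast
  have "N \<subseteq> (\<lambda>x. {a, x}) ` ({..<l} - {a})"
  proof
    fix e assume e: "e \<in> N"
    then obtain x y where "e = {x, y}" "x \<noteq> y" using N by (meson card_2_iff)
    then show "e \<in> (\<lambda>x. {a, x}) ` ({..<l} - {a})" using a(2)[OF e] N[OF e] by auto
  qed
  then have "card N \<le> card ({..<l} - {a})" by (rule surj_card_le[rotated]) simp
  then show ?thesis using a(1) by simp
next
  case star: False
  show ?thesis
  proof (cases "N = {}")
    case False
    then obtain e where e: "e \<in> N" by blast
    then obtain a b where ab: "e = {a, b}" "a \<noteq> b" using N by (meson card_2_iff)
    have lt: "a < l" "b < l" using N[OF e] ab by auto
    obtain e1 where e1: "e1 \<in> N" "a \<notin> e1" using star lt by blast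
    obtain y where y: "e1 = {b, y}" using int[OF e e1(1)] e1 ab N[OF e1(1)]
      by (auto simp: card_2_iff)
    obtain e2 where e2: "e2 \<in> N" "b \<notin> e2" using star lt by blast
    obtain x where x: "e2 = {a, x}" using int[OF e e2(1)] e2 ab N[OF e2(1)]
      by (auto simp: card_2_iff)
    have "x = y" using int[OF e1(1) e2(1)] x y e1(2) e2(2) by auto
    have ne: "a \<noteq> x" "b \<noteq> x" using e1(2) e2(2) x y \<open>x = y\<close> by auto
    have "N \<subseteq> {{a, b}, {a, x}, {b, x}}"
    proof
      fix g assume g: "g \<in> N"
      then obtain u v where uv: "g = {u, v}" "u \<noteq> v" using N by (meson card_2_iff)
      have "u \<in> {a, b} \<or> v \<in> {a, b}" "u \<in> {b, x} \<or> v \<in> {b, x}" "u \<in> {a, x} \<or> v \<in> {a, x}"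
        using int[OF g e] int[OF g e1(1)] int[OF g e2(1)] ab(1) x y \<open>x = y\<close> uv(1) by auto
      then have "u = a \<and> v = b \<or> u = b \<and> v = a \<or> u = a \<and> v = x \<or> u = x \<and> v = a \<or>
          u = b \<and> v = x \<or> u = x \<and> v = b"
        using ab(2) ne by (simp only: insert_iff empty_iff simp_thms) metis
      then show "g \<in> {{a, b}, {a, x}, {b, x}}" unfolding uv(1) by (elim disjE conjE) auto
    qed
    then have "card N \<le> card {{a, b}, {a, x}, {b, x}}" by (rule card_mono[rotated]) simp
    also have "\<dots> \<le> 3" by (simp add: card_insert_if)
    finally show ?thesis using l by simp
  qed simp
qed

definition own :: "'a list set \<Rightarrow> 'a list \<Rightarrow> nat set \<Rightarrow> bool" where
  "own C x e \<longleftrightarrow> (\<forall>y\<in>C. (\<forall>i\<in>e. y ! i = x ! i) \<longrightarrow> y = x)"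

text \<open>Otherwise every \<open>e\<close> in \<open>E\<close> has a codeword other than
  \<open>x\<close> that agrees with \<open>x\<close> on \<open>e\<close>. These at most
  \<open>c\<close> codewords would have \<open>x\<close> as a descendant.\<close>

lemma frameproof_cover:
  assumes "frameproof c F l C" "finite C" "x \<in> C" "finite E" "card E \<le> c" "\<Union>E = {..<l}"
  shows "\<exists>e\<in>E. own C x e"
proof (rule ccontr)
  assume "\<not> ?thesis"
  then have "\<forall>e\<in>E. \<exists>y. y \<in> C - {x} \<and> (\<forall>i\<in>e. y ! i = x ! i)" by (auto simp: own_def)
  then obtain h where h: "\<And>e. e \<in> E \<Longrightarrow> h e \<in> C - {x} \<and> (\<forall>i\<in>e. h e ! i = x ! i)" by metis
  have "card (h ` E) \<le> c" using card_image_le[OF assms(4), of h] assms(5) by simp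
  moreover have "h ` E \<subseteq> C" using h by blast
  ultimately have "desc F l (h ` E) \<inter> C = h ` E" using assms(1) by (auto simp: frameproof_def)
  moreover have "x \<in> desc F l (h ` E)"
  proof -
    have "\<exists>y\<in>h ` E. x ! i = y ! i" if "i < l" for i
    proof -
      have "i \<in> \<Union>E" using that assms(6) by simp
      then show ?thesis using h by force
    qed
    then show ?thesis using assms(1,3) by (auto simp: desc_def frameproof_def)
  qed
  ultimately have "x \<in> h ` E" using assms(3) by blast
  then show False using h by auto
qed

text \<open>Restriction to \<open>e\<close> is injective on the codewords for which \<open>e\<close>
  is own.\<close>

lemma card_own_le:
  assumes "C \<subseteq> words F l" "finite F" "e \<subseteq> {..<l}"
  shows "card {x \<in> C. own C x e} \<le> card F ^ card e"
proof -
  have fin: "finite e" using assms(3) finite_subset by blast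
  let ?r = "\<lambda>x. restrict ((!) x) e"
  have "inj_on ?r {x \<in> C. own C x e}"
  proof (rule inj_onI)
    fix x y assume xy: "x \<in> {x \<in> C. own C x e}" "y \<in> {x \<in> C. own C x e}" "?r x = ?r y"
    have "y ! i = x ! i" if "i \<in> e" for i using fun_cong[OF xy(3), of i] that by simp
    then show "x = y" using xy by (auto simp: own_def)
  qed
  moreover have "?r ` {x \<in> C. own C x e} \<subseteq> e \<rightarrow>\<^sub>E F"
    using assms(1,3) by (auto simp: words_def subset_iff)
  ultimately have "card {x \<in> C. own C x e} \<le> card (e \<rightarrow>\<^sub>E F)"
    using assms(2) fin by (intro card_inj_on_le) (auto intro: finite_PiE)
  then show ?thesis using fin by (simp add: card_funcsetE)
qed

lemma finite_words: "finite F \<Longrightarrow> finite (words F l)"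
  using finite_lists_length_eq[of F l] by (simp add: words_def conj_commute)

text \<open>The quadratic term bounds the codewords in \<open>B\<close>, and the linear term those
  in \<open>A\<close>. The factor \<open>c\<close> keeps the estimate in the natural
  numbers.\<close>

lemma frameproof_card_le:
  assumes c: "c \<ge> 2" and fp: "frameproof c F (c + 2) C" and F: "finite F"
  shows "c * card C \<le> (c + 2) * card F ^ 2 + c * (c + 2) * card F"
proof -
  define l where "l = c + 2"
  define E where "E = {e. e \<subseteq> {..<l} \<and> card e = 2}"
  define A where "A = {x \<in> C. \<exists>i<l. own C x {i}}"
  define B where "B = C - A"
  have CF: "C \<subseteq> words F l" using fp by (simp add: frameproof_def l_def)
  have finC: "finite C" using CF finite_words[OF F] finite_subset by blast
  have finE: "finite E" by (simp add: E_def)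
  have cardE: "card E = (c + 2) choose 2" using n_subsets[of "{..<l}" 2] by (simp add: E_def l_def)
  have "A = (\<Union>i<l. {x \<in> C. own C x {i}})" by (auto simp: A_def)
  also have "card \<dots> \<le> (\<Sum>i<l. card {x \<in> C. own C x {i}})" by (rule card_UN_le) simp
  also have "\<dots> \<le> (\<Sum>i<l. card F)"
    using card_own_le[OF CF F, of "{i}" for i] by (intro sum_mono) auto
  finally have cardA: "card A \<le> (c + 2) * card F" by (simp add: l_def)
  have own_pairs: "(c + 1) choose 2 \<le> card {e \<in> E. own C x e}" if x: "x \<in> B" for x
  proof -
    define N where "N = {e \<in> E. \<not> own C x e}"
    have xC: "x \<in> C" and xi: "\<And>i. i < l \<Longrightarrow> \<not> own C x {i}" using x by (auto simp: A_def B_def)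
    have "e \<inter> e' \<noteq> {}" if e: "e \<in> N" "e' \<in> N" for e e'
    proof
      assume disj: "e \<inter> e' = {}"
      \<comment> \<open>Two disjoint pairs and the remaining \<open>l - 4\<close> singletons: a
        cover by at most \<open>l - 2 = c\<close> sets, none of them own.\<close>
      define G where "G = insert e (insert e' ((\<lambda>i. {i}) ` ({..<l} - (e \<union> e'))))"
      have sub: "e \<union> e' \<subseteq> {..<l}" "card e = 2" "card e' = 2" using e by (auto simp: N_def E_def)
      then have fin: "finite e" "finite e'" by (auto intro: card_ge_0_finite)
      then have "card (e \<union> e') = 4" using disj sub by (simp add: card_Un_disjoint)
      then have "card ({..<l} - (e \<union> e')) = l - 4" using sub fin by (simp add: card_Diff_subset)
      then have "card ((\<lambda>i. {i}) ` ({..<l} - (e \<union> e'))) = l - 4" by (simp add: card_image)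
      then have "card G \<le> Suc (Suc (l - 4))"
        unfolding G_def by (auto simp: card_insert_if)
      then have "card G \<le> c" using c by (simp add: l_def)
      moreover have "\<Union>G = {..<l}" using sub by (auto simp: G_def)
      moreover have "finite G" by (simp add: G_def)
      ultimately have "\<exists>e\<in>G. own C x e"
        using frameproof_cover[OF fp finC xC] unfolding l_def by blast
      then show False using e xi by (auto simp: G_def N_def)
    qed
    then have "card N \<le> l - 1"
      using c by (intro intersecting_pairs_card_le) (auto simp: l_def N_def E_def)
    moreover have "{e \<in> E. own C x e} = E - N" by (auto simp: N_def)
    then have "card {e \<in> E. own C x e} = card E - card N"
      using finE by (simp add: card_Diff_subset N_def)
    moreover have "(c + 2) choose 2 = ((c + 1) choose 2) + (c + 1)"
      using binomial_Suc_Suc[of "c + 1" 1] unfolding Suc_1 choose_one by simp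
    moreover have "l - 1 = c + 1" by (simp add: l_def)
    ultimately show ?thesis using cardE by linarith
  qed
  have finB: "finite B" using finC by (simp add: B_def)
  \<comment> \<open>Double counting of the incidences between codewords in \<open>B\<close> and
    their own pairs.\<close>
  have "card B * ((c + 1) choose 2) \<le> (\<Sum>x\<in>B. card {e \<in> E. own C x e})"
    using sum_bounded_below[of B "(c + 1) choose 2" "\<lambda>x. card {e \<in> E. own C x e}"] own_pairs by simp
  also have "\<dots> = (\<Sum>e\<in>E. card {x \<in> B. own C x e})"
    unfolding card_eq_sum using finB finE by (rule sum.swap_restrict)
  also have "\<dots> \<le> (\<Sum>e\<in>E. card F ^ 2)"
  proof (rule sum_mono)
    fix e assume e: "e \<in> E"
    have "card {x \<in> B. own C x e} \<le> card {x \<in> C. own C x e}"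
      using finC by (intro card_mono) (auto simp: B_def)
    also have "\<dots> \<le> card F ^ card e" using e by (intro card_own_le[OF CF F]) (simp add: E_def)
    finally show "card {x \<in> B. own C x e} \<le> card F ^ 2" using e by (simp add: E_def)
  qed
  also have "\<dots> = ((c + 2) choose 2) * card F ^ 2" using cardE by simp
  finally have "card B * (2 * ((c + 1) choose 2)) \<le> (2 * ((c + 2) choose 2)) * card F ^ 2" by simp
  moreover have "2 * ((c + 1) choose 2) = (c + 1) * c" "2 * ((c + 2) choose 2) = (c + 1) * (c + 2)"
    by (simp_all add: choose_two del: binomial_Suc_Suc)
  ultimately have "(c + 1) * (c * card B) \<le> (c + 1) * ((c + 2) * card F ^ 2)"
    by (simp only: ac_simps)
  then have "c * card B \<le> (c + 2) * card F ^ 2" by (metis mult_le_cancel1 add_gr_0 zero_less_one)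
  moreover have "card C = card A + card B"
  proof -
    have "A \<subseteq> C" by (auto simp: A_def)
    then show ?thesis
      using finC card_mono[of C A] by (simp add: B_def card_Diff_subset finite_subset)
  qed
  moreover have "c * card A \<le> c * ((c + 2) * card F)" using cardA by simp
  ultimately show ?thesis by (simp add: algebra_simps)
qed

section \<open>The maximum \<open>M\<close> and the limit\<close>

lemma finite_frameproof_cards:
  "finite {card C | C. frameproof c {0..<q} l (C :: nat list set)}"
proof (rule finite_subset)
  show "{card C | C. frameproof c {0..<q} l (C :: nat list set)} \<subseteq> {..card (words {0..<q} l)}"
    by (auto simp: frameproof_def intro!: card_mono finite_words)
qed simp

lemma M_attained: "\<exists>C. frameproof c {0..<q} l C \<and> card C = M c l q"
proof -
  have "frameproof c {0..<q} l {}" by (auto simp: frameproof_def)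
  then have "{card C | C. frameproof c {0..<q} l (C :: nat list set)} \<noteq> {}" by auto
  from Max_in[OF finite_frameproof_cards this] show ?thesis by (auto simp: M_def)
qed

lemma card_le_M: "frameproof c {0..<q} l C \<Longrightarrow> card C \<le> M c l q"
  unfolding M_def by (rule Max_ge[OF finite_frameproof_cards]) auto

text \<open>Taking \<open>m \<equiv> 1\<close> modulo \<open>(c + 1)!\<close> instead of \<open>m\<close> prime makes the admissible alphabet sizes
  have bounded gaps, so no result on gaps between primes is needed.\<close>

lemma M_ge:
  assumes "c \<ge> 2" "prime_power (c + 1)" "q > c * fact (c + 1) + c"
  shows "(c + 2) * (q - (1 + c * fact (c + 1)))\<^sup>2 \<le> c * M c (c + 2) q"
proof -
  define K :: nat where "K = fact (c + 1)"
  \<comment> \<open>The largest \<open>d\<close> for which \<open>m = K * d + 1\<close> satisfies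
    \<open>1 + c * m \<le> q\<close>. Raising \<open>d\<close> by one raises \<open>c * m\<close> by
    \<open>c * K\<close>, which bounds the loss.\<close>
  define d where "d = (q - (1 + c)) div (c * K)"
  define m where "m = K * d + 1"
  have "K > 0" by (simp add: K_def)
  then have cK: "c * K > 0" using assms(1) by simp
  have cm: "c * m = (c * K) * d + c" by (simp add: m_def algebra_simps)
  have "(c * K) * d \<le> q - (1 + c)" by (simp add: d_def)
  then have up: "1 + c * m \<le> q" using cm assms(3) by linarith
  have "q - (1 + c) < (c * K) * d + c * K"
    using dividend_less_times_div[OF cK, of "q - (1 + c)"] by (simp add: d_def)
  then have lo: "q - (1 + c * K) \<le> c * m" using cm by linarith
  have "coprime m K"
  proof (rule coprimeI)
    fix e assume "e dvd m" "e dvd K"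
    then show "is_unit e" unfolding m_def using dvd_add_right_iff[of e "K * d" 1] by simp
  qed
  then obtain C where C: "frameproof c {0..<q} (c + 2) C" "card C = c * (c + 2) * m\<^sup>2"
    using frameproof_construction[OF assms(1,2) _ _ up] by (auto simp: K_def m_def)
  have "(c + 2) * (q - (1 + c * K))\<^sup>2 \<le> (c + 2) * (c * m)\<^sup>2"
    using lo by (intro mult_le_mono2 power_mono) auto
  also have "\<dots> = c * card C" unfolding C(2) power2_eq_square by (simp only: mult_ac)
  also have "\<dots> \<le> c * M c (c + 2) q" using card_le_M[OF C(1)] by simp
  finally show ?thesis by (simp add: K_def)
qed

theorem theorem4:
  fixes c :: nat
  assumes "c \<ge> 2" and "prime_power (c + 1)"
  shows "(\<lambda>q. real (M c (c + 2) q) / real q ^ 2) \<longlonglongrightarrow> real (c + 2) / real c"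
proof (rule real_tendsto_sandwich)
  define K :: nat where "K = 1 + c * fact (c + 1)"
  have c: "real c > 0" using assms by simp
  show "\<forall>\<^sub>F q in sequentially. real (c + 2) / real c * (1 - real K / real q)\<^sup>2
          \<le> real (M c (c + 2) q) / real q ^ 2"
  \<comment> \<open>From here on \<open>M_ge\<close> applies, and \<open>K \<le> q\<close> makes the
    natural subtraction \<open>q - K\<close> agree with the real one.\<close>
  proof (rule eventually_sequentiallyI[of "K + c"])
    fix q assume q: "q \<ge> K + c"
    then have "q > 0" by (simp add: K_def)
    have "(c + 2) * (q - K)\<^sup>2 \<le> c * M c (c + 2) q"
      using M_ge[OF assms, of q] q by (simp add: K_def)
    then have "real ((c + 2) * (q - K)\<^sup>2) \<le> real (c * M c (c + 2) q)" by (rule of_nat_mono)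
    then have le: "real (c + 2) * (real q - real K)\<^sup>2 \<le> real c * real (M c (c + 2) q)"
      using q by (simp only: of_nat_mult of_nat_power of_nat_diff)
    have "real (c + 2) / real c * (1 - real K / real q)\<^sup>2
        = (real (c + 2) * (real q - real K)\<^sup>2) / (real c * real q ^ 2)"
      using \<open>q > 0\<close> by (simp add: diff_divide_distrib[symmetric] field_simps power_divide)
    also have "\<dots> \<le> (real c * real (M c (c + 2) q)) / (real c * real q ^ 2)"
      using le by (rule divide_right_mono) simp
    finally show "real (c + 2) / real c * (1 - real K / real q)\<^sup>2 \<le> real (M c (c + 2) q) / real q ^ 2"
      using c by simp
  qed
  show "\<forall>\<^sub>F q in sequentially. real (M c (c + 2) q) / real q ^ 2
          \<le> real (c + 2) / real c + real (c + 2) / real q"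
  proof (rule eventually_sequentiallyI[of 1])
    fix q :: nat assume q: "q \<ge> 1"
    obtain C where C: "frameproof c {0..<q} (c + 2) C" "card C = M c (c + 2) q"
      using M_attained by blast
    have "c * M c (c + 2) q \<le> (c + 2) * q ^ 2 + c * (c + 2) * q"
      using frameproof_card_le[OF assms(1) C(1)] C(2) by simp
    then have "real (c * M c (c + 2) q) \<le> real ((c + 2) * q ^ 2 + c * (c + 2) * q)"
      by (rule of_nat_mono)
    then have "real c * real (M c (c + 2) q)
      \<le> real (c + 2) * real q ^ 2 + real c * real (c + 2) * real q"
      by (simp only: of_nat_mult of_nat_power of_nat_add)
    then show "real (M c (c + 2) q) / real q ^ 2 \<le> real (c + 2) / real c + real (c + 2) / real q"
      using q c by (simp add: field_simps power2_eq_square)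
  qed
  have lim: "(\<lambda>q. a / real q) \<longlonglongrightarrow> 0" for a :: real by (rule lim_const_over_n)
  have "(\<lambda>q. real (c + 2) / real c * (1 - real K / real q)\<^sup>2)
      \<longlonglongrightarrow> real (c + 2) / real c * (1 - 0)\<^sup>2"
    by (intro tendsto_intros lim)
  then show "(\<lambda>q. real (c + 2) / real c * (1 - real K / real q)\<^sup>2) \<longlonglongrightarrow> real (c + 2) / real c"
    by simp
  have "(\<lambda>q. real (c + 2) / real c + real (c + 2) / real q) \<longlonglongrightarrow> real (c + 2) / real c + 0"
    by (intro tendsto_intros lim)
  then show "(\<lambda>q. real (c + 2) / real c + real (c + 2) / real q) \<longlonglongrightarrow> real (c + 2) / real c"
    by simp
qed

end
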